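(* For $N\ge1$, define $$\Lambda_N(t,u)=\frac{(2N)!}{N}\,a_{N-1}(t,u),$$ where $-B'(x)/B(x)=\sum_{r\ge0}a_r(t,u)x^r$. Then $$\Lambda_N(t,u)\in\mathbb N[t,u],\qquad F_{\mathrm{even}}(x)=\exp\Bigl(\sum_{N\ge1}\Lambda_N(t,u)\frac{x^N}{(2N)!}\Bigr).$$ At $u=1$, $$\Lambda_N(t,1)=\frac{(2N)!}{N}\,\Omega(C_{2N}^{\circ};t),$$ where $C_{2N}^{\circ}$ is the alternating circular fence with sign word $(+,-)^N$, with $C_2^{\circ}$ understood as the two-element chain.
   Context: $\mathbb N$ includes $0$. For $m\ge0$ put $m^+=\lceil m/2\rceil$, $m^-=\lfloor m/2\rfloor$ and $\mathsf h_m(t,q)=\frac1{m!}\prod_{i=1}^{m^-}(t+i)\prod_{j=0}^{m^+-1}(t+jq)$, $\mathsf h_0=1$. Set $$B(x)=\sum_{a\ge0}(-1)^a\,\mathsf h_{2a}(t,-u)\,x^a\in\mathbb Q[t,u][[x]].$$ For a composition $\alpha$ with length $\ell(\alpha)$, $Z_\alpha(t,q)=\sum_\gamma(-1)^{\ell(\alpha)-\ell(\gamma)}\prod_j\mathsf h_{\gamma_j}(t,q)$, summed over all coarsenings $\gamma$ of $\alpha$ (compositions obtained by repeatedly replacing adjacent parts by their sum, $\alpha$ included), $Z_\varnothing=1$. With $\delta_{2N}=(2,\dots,2)$ ($N$ parts), $\delta_0=\varnothing$, $F_{\mathrm{even}}(x)=\sum_{N\ge0}Z_{\delta_{2N}}(t,-u)x^N$,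 which equals $B(x)^{-1}$. For a finite poset $P$, $\Omega(P;t)$ is the order polynomial: for each positive integer $m$, $\Omega(P;m)$ is the number of weakly order-preserving maps $f:P\to[m]=\{1,\dots,m\}$ ($x\le_P y\Rightarrow f(x)\le f(y)$). For $N\ge2$, the alternating circular fence $C_{2N}^\circ$ is the poset on $\{x_1,\dots,x_{2N}\}$ with cover relations $x_1<x_2>x_3<x_4>\cdots<x_{2N}>x_1$ (alternating cyclically, $N$ minimal and $N$ maximal elements). *)

theory Defs
  imports
    "HOL-Computational_Algebra.Computational_Algebra"
    "HOL-Library.FuncSet"
begin

section \<open>The ring of polynomials in \<open>t\<close> and \<open>u\<close>\<close>

text \<open>
  The ring $\mathbb{Q}[t,u]$ is \<open>rat poly poly\<close>, with \<open>t\<close> the indeterminate of the inner and \<open>u\<close>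
  the indeterminate of the outer polynomial ring.  Thus \<open>coeff (coeff p j) i\<close> is the coefficient
  of $t^i u^j$ in \<open>p\<close>, and \<open>poly p 1 :: rat poly\<close> is the specialisation of \<open>p\<close> at $u = 1$.
\<close>

type_synonym qtu = "rat poly poly"

definition tt :: qtu where "tt = [:[:0, 1:]:]"

definition uu :: qtu where "uu = [:0, 1:]"

definition qconst :: "rat \<Rightarrow> qtu" where "qconst c = [:[:c:]:]"

definition nat_polys :: "qtu set"
  where "nat_polys = {p. \<forall>i j. coeff (coeff p j) i \<in> \<nat>}"

section \<open>The polynomials \<open>h\<close> and the series \<open>B\<close>\<close>

text \<open>Here \<open>m div 2\<close> and \<open>(m + 1) div 2\<close> are the floor and the ceiling of $m/2$.\<close>

definition hh :: "nat \<Rightarrow> qtu \<Rightarrow> qtu \<Rightarrow> qtu"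
  where "hh m t q = qconst (1 / fact m) *
    (\<Prod>i = 1..m div 2. t + of_nat i) * (\<Prod>j < (m + 1) div 2. t + of_nat j * q)"

lemma hh_0: "hh 0 t q = 1"
  by (simp add: hh_def qconst_def one_pCons)

definition B_series :: "qtu fps"
  where "B_series = Abs_fps (\<lambda>a. (-1) ^ a * hh (2 * a) tt (- uu))"

lemma B_series_nth_0: "B_series $ 0 = 1"
  by (simp add: B_series_def hh_0)

section \<open>Coarsenings and the series \<open>F_even\<close>\<close>

text \<open>A composition is the list of its parts.\<close>

inductive merge :: "nat list \<Rightarrow> nat list \<Rightarrow> bool"
  where "merge (xs @ a # b # ys) (xs @ (a + b) # ys)"

definition coarsenings :: "nat list \<Rightarrow> nat list set"
  where "coarsenings \<alpha> = {\<gamma>. merge\<^sup>*\<^sup>* \<alpha> \<gamma>}"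

definition Z_comp :: "nat list \<Rightarrow> qtu \<Rightarrow> qtu \<Rightarrow> qtu"
  where "Z_comp \<alpha> t q =
    (\<Sum>\<gamma> \<in> coarsenings \<alpha>. (-1) ^ (length \<alpha> - length \<gamma>) * (\<Prod>g \<leftarrow> \<gamma>. hh g t q))"

lemma merge_invariant:
  assumes "merge\<^sup>*\<^sup>* \<alpha> \<gamma>"
  shows "sum_list \<gamma> = sum_list \<alpha> \<and> length \<gamma> \<le> length \<alpha>"
  using assms by induction (auto elim!: merge.cases)

lemma finite_coarsenings: "finite (coarsenings \<alpha>)"
proof (rule finite_subset)
  show "coarsenings \<alpha> \<subseteq> {\<gamma>. set \<gamma> \<subseteq> {..sum_list \<alpha>} \<and> length \<gamma> \<le> length \<alpha>}"
    using merge_invariant member_le_sum_list unfolding coarsenings_def by fastforce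
qed (simp add: finite_lists_length_le)

lemma coarsenings_Nil: "coarsenings [] = {[]}"
  using merge_invariant[of "[]"] by (auto simp: coarsenings_def)

lemma Z_comp_Nil: "Z_comp [] t q = 1"
  by (simp add: Z_comp_def coarsenings_Nil)

definition F_even :: "qtu fps"
  where "F_even = Abs_fps (\<lambda>N. Z_comp (replicate N 2) tt (- uu))"

section \<open>The polynomials \<open>\<Lambda>\<close>\<close>

text \<open>
  The coefficient ring is not a field, so that power series division is expressed by
  \<^const>\<open>fps_right_inverse_constructor\<close>; the second argument of \<open>fps_right_inverse\<close> is the inverse
  of the constant term of the series.
\<close>

definition log_deriv_coeff :: "nat \<Rightarrow> qtu"
  where "log_deriv_coeff r = (- fps_deriv B_series * fps_right_inverse B_series 1) $ r"

lemma B_series_right_inverse: "B_series * fps_right_inverse B_series 1 = 1"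
  by (rule fps_right_inverse) (simp add: B_series_nth_0)

definition Lambda :: "nat \<Rightarrow> qtu"
  where "Lambda N = qconst (fact (2 * N) / of_nat N) * log_deriv_coeff (N - 1)"

text \<open>
  The exponential of a power series with zero constant term; \<^const>\<open>fps_exp\<close> needs a coefficient
  field.
\<close>

definition exp_fps :: "qtu fps \<Rightarrow> qtu fps"
  where "exp_fps G = fps_compose (Abs_fps (\<lambda>n. qconst (1 / fact n))) G"

section \<open>Order polynomials and circular fences\<close>

definition order_preserving_maps :: "'a set \<Rightarrow> 'a rel \<Rightarrow> nat \<Rightarrow> ('a \<Rightarrow> nat) set"
  where "order_preserving_maps A r m = {f \<in> A \<rightarrow>\<^sub>E {1..m}. \<forall>(x, y) \<in> r. f x \<le> f y}"

definition order_polynomial :: "'a set \<Rightarrow> 'a rel \<Rightarrow> rat poly"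
  where "order_polynomial A r =
    (THE p. \<forall>m \<ge> 1. poly p (of_nat m) = of_nat (card (order_preserving_maps A r m)))"

text \<open>The description in \<open>order_polynomial_def\<close> determines a polynomial for every finite poset.\<close>

definition surj_maps :: "'a set \<Rightarrow> 'a rel \<Rightarrow> nat set \<Rightarrow> ('a \<Rightarrow> nat) set"
  where "surj_maps A r S = {f \<in> A \<rightarrow>\<^sub>E S. f ` A = S \<and> (\<forall>(x, y) \<in> r. f x \<le> f y)}"

lemma card_surj_maps:
  assumes "finite S" and r: "r \<subseteq> A \<times> A"
  shows "card (surj_maps A r S) = card (surj_maps A r {..<card S})"
proof -
  obtain h where h: "bij_betw h {..<card S} S" "strict_mono_on {..<card S} h"
    using ex_bij_betw_strict_mono_card[OF assms(1)] by metis
  have inj: "inj_on h {..<card S}" and img: "h ` {..<card S} = S"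
    using h(1) by (auto simp: bij_betw_def)
  have le: "h x \<le> h y \<longleftrightarrow> x \<le> y" if "x \<in> {..<card S}" "y \<in> {..<card S}" for x y
    using strict_mono_on_less_eq[OF h(2) that] .
  let ?k = "the_inv_into {..<card S} h"
  have "bij_betw (\<lambda>f. restrict (h \<circ> f) A) (surj_maps A r {..<card S}) (surj_maps A r S)"
  proof (rule bij_betwI[where g = "\<lambda>f. restrict (?k \<circ> f) A"])
    show "(\<lambda>f. restrict (h \<circ> f) A) \<in> surj_maps A r {..<card S} \<rightarrow> surj_maps A r S"
    proof
      fix f assume f: "f \<in> surj_maps A r {..<card S}"
      then have fA: "f ` A = {..<card S}" by (simp add: surj_maps_def)
      have "h (f x) \<le> h (f y)" if "(x, y) \<in> r" for x y
        using f that r fA le[of "f x" "f y"] by (fastforce simp: surj_maps_def)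
      moreover have hfA: "(\<lambda>x. h (f x)) ` A = S" using fA img by (metis image_image)
      moreover have "h (f x) \<in> S" if "x \<in> A" for x using hfA that by blast
      ultimately show "restrict (h \<circ> f) A \<in> surj_maps A r S"
        using r by (auto simp: surj_maps_def)
    qed
    show "(\<lambda>f. restrict (?k \<circ> f) A) \<in> surj_maps A r S \<rightarrow> surj_maps A r {..<card S}"
    proof
      fix f assume f: "f \<in> surj_maps A r S"
      then have fA: "f ` A = S" by (simp add: surj_maps_def)
      have kS: "?k ` S = {..<card S}" using the_inv_into_onto[OF inj] img by simp
      have kin: "?k s \<in> {..<card S}" if "s \<in> S" for s using kS that by blast
      have hk: "h (?k s) = s" if "s \<in> S" for s
        using f_the_inv_into_f[OF inj] img that by simp
      have "?k (f x) \<le> ?k (f y)" if "(x, y) \<in> r" for x y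
      proof -
        have "f x \<in> S" "f y \<in> S" "f x \<le> f y"
          using f that r fA by (auto simp: surj_maps_def)
        then show ?thesis using le[OF kin kin] hk by metis
      qed
      moreover have kfA: "(\<lambda>x. ?k (f x)) ` A = {..<card S}" using fA kS by (metis image_image)
      moreover have "?k (f x) < card S" if "x \<in> A" for x using kfA that by blast
      ultimately show "restrict (?k \<circ> f) A \<in> surj_maps A r {..<card S}"
        using r by (auto simp: surj_maps_def)
    qed
    show "restrict (?k \<circ> restrict (h \<circ> f) A) A = f" if "f \<in> surj_maps A r {..<card S}" for f
    proof
      fix x
      have f: "f \<in> A \<rightarrow>\<^sub>E {..<card S}" using that by (simp add: surj_maps_def)
      show "restrict (?k \<circ> restrict (h \<circ> f) A) A x = f x"
      proof (cases "x \<in> A")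
        case True
        then show ?thesis using the_inv_into_f_f[OF inj PiE_mem[OF f True]] by simp
      next
        case False
        then show ?thesis using PiE_arb[OF f False] by simp
      qed
    qed
    show "restrict (h \<circ> restrict (?k \<circ> f) A) A = f" if "f \<in> surj_maps A r S" for f
    proof
      fix x
      have f: "f \<in> A \<rightarrow>\<^sub>E S" using that by (simp add: surj_maps_def)
      show "restrict (h \<circ> restrict (?k \<circ> f) A) A x = f x"
      proof (cases "x \<in> A")
        case True
        have "f x \<in> h ` {..<card S}" using PiE_mem[OF f True] by (simp only: img)
        from f_the_inv_into_f[OF inj this] True show ?thesis by simp
      next
        case False
        then show ?thesis using PiE_arb[OF f False] by simp
      qed
    qed
  qed
  then show ?thesis by (simp add: bij_betw_same_card)
qed

lemma card_order_preserving_maps: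
  assumes "finite A" and r: "r \<subseteq> A \<times> A"
  shows "card (order_preserving_maps A r m) =
    (\<Sum>k\<le>card A. (m choose k) * card (surj_maps A r {..<k}))"
proof -
  let ?S = "{S. S \<subseteq> {1..m} \<and> card S \<le> card A}"
  have finS: "finite ?S" by (rule finite_subset[of _ "Pow {1..m}"]) auto
  have fin: "finite (surj_maps A r S)" if "S \<in> ?S" for S
    by (rule finite_subset[of _ "A \<rightarrow>\<^sub>E S"])
      (use that assms(1) in \<open>auto simp: surj_maps_def intro!: finite_PiE finite_subset[of S "{1..m}"]\<close>)
  have "order_preserving_maps A r m = (\<Union>S\<in>?S. surj_maps A r S)"
  proof (intro equalityI subsetI)
    fix f assume "f \<in> order_preserving_maps A r m"
    then show "f \<in> (\<Union>S\<in>?S. surj_maps A r S)"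
      using card_image_le[OF assms(1), of f]
      by (intro UN_I[of "f ` A"]) (auto simp: order_preserving_maps_def surj_maps_def PiE_def)
  qed (fastforce simp: order_preserving_maps_def surj_maps_def PiE_def)
  then have "card (order_preserving_maps A r m) = (\<Sum>S\<in>?S. card (surj_maps A r S))"
    using finS fin by (simp, subst card_UN_disjoint) (auto simp: surj_maps_def)
  also have "\<dots> = (\<Sum>S\<in>?S. card (surj_maps A r {..<card S}))"
    by (intro sum.cong refl card_surj_maps r) (blast intro: finite_subset[of _ "{1..m}"])
  also have "\<dots> = (\<Sum>k\<le>card A. \<Sum>S\<in>{S\<in>?S. card S = k}. card (surj_maps A r {..<card S}))"
    using finS by (intro sum.group[symmetric]) auto
  also have "\<dots> = (\<Sum>k\<le>card A. (m choose k) * card (surj_maps A r {..<k}))"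
  proof (intro sum.cong refl)
    fix k assume "k \<in> {..card A}"
    then have "{S\<in>?S. card S = k} = {S. S \<subseteq> {1..m} \<and> card S = k}" by auto
    then show "(\<Sum>S\<in>{S\<in>?S. card S = k}. card (surj_maps A r {..<card S})) =
        (m choose k) * card (surj_maps A r {..<k})"
      using n_subsets[of "{1..m}" k] by simp
  qed
  finally show ?thesis .
qed

lemma order_polynomial_unique:
  fixes p p' :: "rat poly"
  assumes "\<forall>m \<ge> 1. poly p (of_nat m) = poly p' (of_nat m)"
  shows "p = p'"
proof (rule ccontr)
  assume "p \<noteq> p'"
  then have "finite {x. poly (p - p') x = 0}" by (intro poly_roots_finite) simp
  moreover have "of_nat ` {1::nat..} \<subseteq> {x. poly (p - p') x = 0}" using assms by auto
  ultimately have "finite (of_nat ` {1::nat..} :: rat set)" by (rule rev_finite_subset)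
  then have "finite {1::nat..}" by (rule finite_imageD) (simp add: inj_on_def)
  then show False by (simp add: infinite_Ici)
qed

lemma order_polynomial_ex:
  assumes "finite A" "r \<subseteq> A \<times> A"
  shows "\<exists>p :: rat poly. \<forall>m. poly p (of_nat m) = of_nat (card (order_preserving_maps A r m))"
proof -
  define p :: "rat poly" where "p = (\<Sum>k\<le>card A.
    smult (of_nat (card (surj_maps A r {..<k})) / fact k) (\<Prod>i<k. [:- of_nat i, 1:]))"
  have "poly p (of_nat m) = of_nat (card (order_preserving_maps A r m))" for m
    unfolding p_def card_order_preserving_maps[OF assms]
    by (simp add: poly_sum poly_prod binomial_gbinomial gbinomial_prod_rev atLeast0LessThan
        mult_ac)
  then show ?thesis by blast
qed

lemma order_polynomial:
  assumes "partial_order_on A r" "finite A" "m \<ge> 1"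
  shows "poly (order_polynomial A r) (of_nat m) = of_nat (card (order_preserving_maps A r m))"
proof -
  have "r \<subseteq> A \<times> A" using assms(1) by (rule partial_order_onD)
  then have "\<exists>!p :: rat poly. \<forall>m \<ge> 1.
      poly p (of_nat m) = of_nat (card (order_preserving_maps A r m))"
    using order_polynomial_ex[OF assms(2)] order_polynomial_unique by (metis (no_types, lifting))
  from theI'[OF this] show ?thesis using assms(3) by (simp add: order_polynomial_def)
qed

text \<open>
  The element $x_i$ of the circular fence is represented by \<open>i\<close>.  Every cover relation has the form
  $x_i < x_{i+1}$ with \<open>i\<close> odd, or $x_{i+1} < x_i$ with \<open>i\<close> even, where $x_{2N+1} = x_1$.  The
  relation \<open>circ_fence_less\<close> has no composable pairs, so that its reflexive closure is the order
  it generates.  For $N = 1$ both kinds of relation reduce to $x_1 < x_2$, and the definition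
  yields the two-element chain.
\<close>

definition circ_fence :: "nat \<Rightarrow> nat set"
  where "circ_fence N = {1..2 * N}"

definition circ_fence_less :: "nat \<Rightarrow> nat rel"
  where "circ_fence_less N =
    {(i, i + 1) |i. i \<in> circ_fence N \<and> odd i} \<union>
    {(i mod (2 * N) + 1, i) |i. i \<in> circ_fence N \<and> even i}"

definition circ_fence_le :: "nat \<Rightarrow> nat rel"
  where "circ_fence_le N = Id_on (circ_fence N) \<union> circ_fence_less N"

lemma circ_fence_less_parity:
  assumes "(x, y) \<in> circ_fence_less N"
  shows "x \<in> circ_fence N \<and> y \<in> circ_fence N \<and> odd x \<and> even y"
proof -
  have "i mod (2 * N) + 1 \<in> circ_fence N" if "i \<in> circ_fence N" for i
    using that mod_less_divisor[of "2 * N" i] unfolding circ_fence_def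
    by (auto simp: Suc_le_eq simp del: mod_less_divisor)
  moreover have "i + 1 \<in> circ_fence N" if "i \<in> circ_fence N" "odd i" for i
    using that by (cases "i = 2 * N") (auto simp: circ_fence_def)
  moreover have "even (i mod (2 * N))" if "even i" for i
    using that by (simp add: dvd_mod_iff)
  moreover consider i where "x = i" "y = i + 1" "i \<in> circ_fence N" "odd i"
    | i where "x = i mod (2 * N) + 1" "y = i" "i \<in> circ_fence N" "even i"
    using assms unfolding circ_fence_less_def by blast
  ultimately show ?thesis by cases (metis even_plus_one_iff)+
qed

lemma partial_order_on_circ_fence: "partial_order_on (circ_fence N) (circ_fence_le N)"
  unfolding partial_order_on_def preorder_on_def circ_fence_le_def
  by (auto intro!: refl_onI transI antisymI dest: circ_fence_less_parity)

lemma circ_fence_1: "circ_fence_less 1 = {(1, 2)}"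
proof -
  have "circ_fence 1 = {1, 2}" by (auto simp: circ_fence_def)
  then show ?thesis by (auto simp: circ_fence_less_def)
qed

end

theory Submission
  imports Defs
begin

text \<open>
  Write \<open>A = - B'/B = (\<Sum>r. a\<^sub>r x\<^sup>r)\<close>.

  \<^emph>\<open>Exponential formula.\<close>  The coarsenings of \<open>(2, \<dots>, 2)\<close> are the compositions of \<open>2N\<close> into even
  parts.  Splitting off the first part shows \<open>F B = 1\<close> for the series \<open>F\<close> of the statement
  (\<open>F_even_mult_B_series\<close>).  The exponent in the statement is the antiderivative of \<open>A\<close> with constant
  term \<open>0\<close>, so the product of its exponential with \<open>B\<close> has derivative \<open>0\<close> and is also equal to \<open>1\<close>
  (\<open>F_even_eq_exp_fps\<close>).

  \<^emph>\<open>Coefficients.\<close>  The coefficients of \<open>B\<close> satisfy a hypergeometric recurrence, so \<open>B\<close> satisfies a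
  linear differential equation of second order and \<open>A\<close> a Riccati equation.  Comparing coefficients
  yields the quadratic recurrence \<open>log_deriv_coeff_rec\<close> for \<open>a\<^sub>r\<close>.  Its negative terms are dominated
  by positive ones once the inequality \<open>4 a\<^sub>r\<^sub>+\<^sub>1 \<ge> u a\<^sub>r\<close> between coefficients is proved along with
  nonnegativity (\<open>log_deriv_coeff_nonneg\<close>).  Rewritten for \<open>\<Lambda>\<close>, the recurrence has integral
  coefficients, because \<open>2r choose (2i + 1)\<close> is even (\<open>Lambda_rec\<close>).

  \<^emph>\<open>Fences.\<close>  At \<open>u = 1\<close> and \<open>t = m\<close> the series \<open>B\<close> is \<open>D = det(1 - x M)\<close> for the \<open>m \<times> m\<close> matrix \<open>M\<close>
  with entries \<open>min i j\<close>.  An order-preserving map of the circular fence into \<open>{1..m}\<close> amounts to a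
  cyclic sequence of values at the maximal elements, with \<open>min i j\<close> choices for the minimal element
  below two neighbours of values \<open>i\<close> and \<open>j\<close>; hence there are \<open>tr(M\<^sup>N)\<close> such maps.  The claim is
  then the trace formula \<open>- D'/D = (\<Sum>N. tr(M\<^sup>N\<^sup>+\<^sup>1) x\<^sup>N)\<close>.  Determinants can be bypassed: \<open>M\<close> is the
  inverse of a second-difference operator, so the resolvent is an explicit product of two solutions
  of a three-term recurrence divided by \<open>D\<close> (\<open>B_at_mult_zigzag_fps\<close>), and the diagonal
  values of that product sum to \<open>- D'\<close> (\<open>sum_cheb_B_at\<close>).
\<close>

section \<open>The logarithmic derivative of \<open>B\<close>\<close>

lemma qconst_mult: "qconst (a * b) = qconst a * qconst b"
  by (simp add: qconst_def)

lemma qconst_of_nat: "qconst (of_nat n) = of_nat n"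
  by (simp add: qconst_def of_nat_poly)

lemma qconst_1: "qconst 1 = 1"
  using qconst_of_nat[of 1] by simp

lemma qconst_numeral: "qconst (numeral n) = numeral n"
  using qconst_of_nat[of "numeral n"] by simp

definition log_deriv :: "qtu fps"
  where "log_deriv = Abs_fps log_deriv_coeff"

lemma log_deriv_eq: "log_deriv = - fps_deriv B_series * fps_right_inverse B_series 1"
  by (rule fps_ext) (simp add: log_deriv_def log_deriv_coeff_def)

lemma fps_deriv_B_series: "fps_deriv B_series = - (log_deriv * B_series)"
proof -
  have "log_deriv * B_series = - fps_deriv B_series * (B_series * fps_right_inverse B_series 1)"
    unfolding log_deriv_eq by (simp only: mult_ac)
  then show ?thesis by (simp add: B_series_right_inverse)
qed

section \<open>The reciprocal of \<open>B\<close> as a sum over coarsenings\<close>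

lemma merge_Cons: "merge \<alpha> \<gamma> \<Longrightarrow> merge (x # \<alpha>) (x # \<gamma>)"
  by (auto elim!: merge.cases intro: merge.intros[of "x # _", simplified])

lemma merge_rtranclp_Cons: "merge\<^sup>*\<^sup>* \<alpha> \<gamma> \<Longrightarrow> merge\<^sup>*\<^sup>* (x # \<alpha>) (x # \<gamma>)"
  by (induction rule: rtranclp_induct) (auto intro: rtranclp.rtrancl_into_rtrancl merge_Cons)

lemma merge_replicate: "merge\<^sup>*\<^sup>* (c # replicate k 2 @ \<beta>) ((c + 2 * k) # \<beta>)"
proof (induction k arbitrary: c)
  case (Suc k)
  have "merge (c # 2 # (replicate k 2 @ \<beta>)) ((c + 2) # (replicate k 2 @ \<beta>))"
    using merge.intros[of "[]" c 2 "replicate k 2 @ \<beta>"] by simp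
  with Suc[of "c + 2"] show ?case
    by (auto intro: converse_rtranclp_into_rtranclp)
qed simp

lemma coarsenings_replicate_2:
  "coarsenings (replicate N 2) = {\<gamma>. (\<forall>g \<in> set \<gamma>. even g \<and> g > 0) \<and> sum_list \<gamma> = 2 * N}"
proof (intro equalityI subsetI CollectI conjI)
  fix \<gamma> assume "\<gamma> \<in> coarsenings (replicate N 2)"
  then have *: "merge\<^sup>*\<^sup>* (replicate N 2) \<gamma>" by (simp add: coarsenings_def)
  then show "sum_list \<gamma> = 2 * N"
    using merge_invariant[OF *] by (simp add: sum_list_replicate)
  from * show "\<forall>g \<in> set \<gamma>. even g \<and> g > 0"
    by (induction rule: rtranclp_induct) (auto elim!: merge.cases)
next
  fix \<gamma> :: "nat list"
  assume "\<gamma> \<in> {\<gamma>. (\<forall>g \<in> set \<gamma>. even g \<and> g > 0) \<and> sum_list \<gamma> = 2 * N}"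
  then have "\<forall>g \<in> set \<gamma>. even g \<and> g > 0" "sum_list \<gamma> = 2 * N" by auto
  then have "merge\<^sup>*\<^sup>* (replicate N 2) \<gamma>"
  proof (induction \<gamma> arbitrary: N)
    case (Cons g \<gamma>)
    obtain b where "g = 2 * b" "b > 0" using Cons.prems(1) by auto
    then obtain k where g: "g = 2 + 2 * k" by (cases b) auto
    define M where "M = N - Suc k"
    have N: "N = Suc k + M" and M: "sum_list \<gamma> = 2 * M"
      using Cons.prems(2) g by (auto simp: M_def)
    have "merge\<^sup>*\<^sup>* (2 # replicate k 2 @ replicate M 2) (g # replicate M 2)"
      using merge_replicate[of 2 k] g by simp
    also have "merge\<^sup>*\<^sup>* (g # replicate M 2) (g # \<gamma>)"
      using Cons M by (intro merge_rtranclp_Cons) auto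
    finally show ?case by (simp add: N replicate_add)
  qed simp
  then show "\<gamma> \<in> coarsenings (replicate N 2)" by (simp add: coarsenings_def)
qed

lemma coarsenings_replicate_2_Suc:
  "coarsenings (replicate (Suc N) 2) =
    (\<Union>k\<le>N. (#) (2 * (k + 1)) ` coarsenings (replicate (N - k) 2))"
proof (intro equalityI subsetI)
  fix \<gamma> assume "\<gamma> \<in> coarsenings (replicate (Suc N) 2)"
  then have \<gamma>: "\<forall>g \<in> set \<gamma>. even g \<and> g > 0" "sum_list \<gamma> = 2 * Suc N"
    by (auto simp: coarsenings_replicate_2 simp del: replicate_Suc)
  then obtain g \<gamma>' where g: "\<gamma> = g # \<gamma>'" by (cases \<gamma>) auto
  then obtain b where "g = 2 * b" "b > 0" using \<gamma>(1) by auto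
  then obtain k where "g = 2 * (k + 1)" by (cases b) auto
  with g \<gamma> show "\<gamma> \<in> (\<Union>k\<le>N. (#) (2 * (k + 1)) ` coarsenings (replicate (N - k) 2))"
    by (intro UN_I[of k]) (auto simp: coarsenings_replicate_2)
qed (auto simp: coarsenings_replicate_2 simp del: replicate_Suc)

text \<open>
  As \<open>(-1)\<^sup>k\<^sup>+\<^sup>1 h\<^sub>2\<^sub>(\<^sub>k\<^sub>+\<^sub>1\<^sub>)\<close> is a coefficient of \<open>B\<close>, this is the recurrence that characterises the
  coefficients of \<open>1/B\<close>.
\<close>

lemma Z_comp_replicate_2_Suc:
  "Z_comp (replicate (Suc N) 2) t q =
    (\<Sum>k\<le>N. (-1) ^ k * hh (2 * (k + 1)) t q * Z_comp (replicate (N - k) 2) t q)"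
proof -
  let ?w = "\<lambda>N \<gamma>. (-1) ^ (N - length \<gamma>) * (\<Prod>g \<leftarrow> \<gamma>. hh g t q)"
  have "Z_comp (replicate (Suc N) 2) t q =
      (\<Sum>k\<le>N. \<Sum>\<gamma> \<in> (#) (2 * (k + 1)) ` coarsenings (replicate (N - k) 2). ?w (Suc N) \<gamma>)"
    unfolding Z_comp_def coarsenings_replicate_2_Suc length_replicate
    by (rule sum.UNION_disjoint) (auto simp: finite_coarsenings)
  also have "\<dots> = (\<Sum>k\<le>N. \<Sum>\<gamma> \<in> coarsenings (replicate (N - k) 2). ?w (Suc N) (2 * (k + 1) # \<gamma>))"
    by (subst sum.reindex) (simp_all add: inj_on_def)
  also have "\<dots> = (\<Sum>k\<le>N. \<Sum>\<gamma> \<in> coarsenings (replicate (N - k) 2).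
      (-1) ^ k * hh (2 * (k + 1)) t q * ?w (N - k) \<gamma>)"
  proof (intro sum.cong refl)
    fix k \<gamma> assume k: "k \<in> {..N}" and \<gamma>: "\<gamma> \<in> coarsenings (replicate (N - k) 2)"
    have "length \<gamma> \<le> N - k"
      using merge_invariant[of "replicate (N - k) 2" \<gamma>] \<gamma> by (simp add: coarsenings_def)
    then have "Suc N - length (2 * (k + 1) # \<gamma>) = k + (N - k - length \<gamma>)" using k by simp
    then show "?w (Suc N) (2 * (k + 1) # \<gamma>) = (-1) ^ k * hh (2 * (k + 1)) t q * ?w (N - k) \<gamma>"
      by (simp only: power_add list.map prod_list.Cons mult_ac)
  qed
  finally show ?thesis by (simp add: Z_comp_def sum_distrib_left)
qed

lemma F_even_mult_B_series: "F_even * B_series = 1"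
proof (rule fps_ext)
  fix n
  show "(F_even * B_series) $ n = 1 $ n"
  proof (cases n)
    case 0
    then show ?thesis by (simp add: F_even_def Z_comp_Nil B_series_nth_0)
  next
    case (Suc N)
    have "(B_series * F_even) $ Suc N = F_even $ Suc N + (\<Sum>k\<le>N. B_series $ (k + 1) * F_even $ (N - k))"
      by (simp add: fps_mult_nth atLeast0AtMost sum.atMost_Suc_shift B_series_nth_0 del: sum.atMost_Suc)
    also have "(\<Sum>k\<le>N. B_series $ (k + 1) * F_even $ (N - k)) = - F_even $ Suc N"
      by (simp add: B_series_def F_even_def Z_comp_replicate_2_Suc mult.assoc sum_negf
          del: replicate_Suc)
    finally show ?thesis using Suc by (simp add: mult.commute)
  qed
qed

section \<open>The exponential formula\<close>

lemma fps_deriv_exp_fps: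
  assumes "G $ 0 = 0"
  shows "fps_deriv (exp_fps G) = exp_fps G * fps_deriv G"
proof -
  have "fps_deriv (Abs_fps (\<lambda>n. qconst (1 / fact n))) = Abs_fps (\<lambda>n. qconst (1 / fact n))"
  proof (rule fps_ext)
    fix n
    have "of_nat (n + 1) * qconst (1 / fact (n + 1)) = qconst (of_nat (n + 1) * (1 / fact (n + 1)))"
      by (simp add: qconst_def of_nat_poly)
    then show "fps_deriv (Abs_fps (\<lambda>n. qconst (1 / fact n))) $ n = Abs_fps (\<lambda>n. qconst (1 / fact n)) $ n"
      by simp
  qed
  then show ?thesis using fps_compose_deriv[OF assms] by (simp add: exp_fps_def)
qed

lemma exp_fps_nth_0: "G $ 0 = 0 \<Longrightarrow> exp_fps G $ 0 = 1"
  by (simp add: exp_fps_def qconst_def one_pCons)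

lemma F_even_eq_exp_fps:
  "F_even = exp_fps (Abs_fps (\<lambda>N. if N \<ge> 1 then Lambda N * qconst (1 / fact (2 * N)) else 0))"
proof -
  define G where "G = Abs_fps (\<lambda>N. if N \<ge> 1 then Lambda N * qconst (1 / fact (2 * N)) else 0)"
  have G0: "G $ 0 = 0" by (simp add: G_def)
  have G': "fps_deriv G = log_deriv"
  proof (rule fps_ext)
    fix n
    let ?q = "of_nat (n + 1) * (fact (2 * (n + 1)) / of_nat (n + 1)) * (1 / fact (2 * (n + 1))) :: rat"
    have "fps_deriv G $ n = qconst ?q * log_deriv_coeff n"
      by (simp add: G_def Lambda_def qconst_mult qconst_of_nat mult_ac
          del: fact_Suc of_nat_Suc of_nat_add times_divide_eq_left times_divide_eq_right mult_1_right mult_1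
            nonzero_mult_div_cancel_left nonzero_mult_div_cancel_right mult_Suc_right)
    also have "?q = 1" by (simp del: fact_Suc of_nat_Suc of_nat_add mult_Suc_right)
    finally show "fps_deriv G $ n = log_deriv $ n" by (simp add: qconst_1 log_deriv_def)
  qed
  have "fps_deriv (exp_fps G * B_series) = 0"
    by (simp add: fps_deriv_exp_fps[OF G0] G' fps_deriv_B_series algebra_simps)
  then have "exp_fps G * B_series = F_even * B_series"
    unfolding fps_deriv_eq_0_iff F_even_mult_B_series
    by (simp add: exp_fps_nth_0[OF G0] B_series_nth_0)
  moreover have "B_series \<noteq> 0" using B_series_nth_0 by (metis fps_zero_nth zero_neq_one)
  ultimately show ?thesis by (simp add: G_def)
qed

section \<open>The Riccati equation\<close>

text \<open>
  The ratio of consecutive coefficients of a hypergeometric series: up to rescaling of the variable,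
  \<open>B\<close> is \<open>2F1(t + 1, - t/u; 1/2)\<close>.  The denominators are cleared so that \<open>u\<close> never has to be
  inverted.
\<close>

lemma B_series_rec:
  "of_nat ((2 * a + 2) * (2 * a + 1)) * B_series $ (a + 1) =
    (of_nat a * uu - tt) * (tt + of_nat (a + 1)) * B_series $ a"
proof -
  define P where "P = (\<Prod>i = 1..a. tt + of_nat i) * (\<Prod>j < a. tt + of_nat j * (- uu))"
  have hh_even: "hh (2 * k) tt (- uu) = qconst (1 / fact (2 * k)) *
      ((\<Prod>i = 1..k. tt + of_nat i) * (\<Prod>j < k. tt + of_nat j * (- uu)))" for k
    by (simp add: hh_def mult.assoc)
  have *: "1 / fact (2 * a) = of_nat ((2 * a + 2) * (2 * a + 1)) * (1 / fact (2 * (a + 1)) :: rat)"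
    by (simp add: fact_reduce divide_simps del: of_nat_mult) (simp add: algebra_simps)
  have "of_nat ((2 * a + 2) * (2 * a + 1)) * hh (2 * (a + 1)) tt (- uu) =
      (of_nat ((2 * a + 2) * (2 * a + 1)) * qconst (1 / fact (2 * (a + 1)))) *
      (P * (tt + of_nat (a + 1)) * (tt + of_nat a * (- uu)))"
    unfolding hh_even P_def by (simp add: algebra_simps)
  also have "of_nat ((2 * a + 2) * (2 * a + 1)) * qconst (1 / fact (2 * (a + 1))) =
      qconst (1 / fact (2 * a))"
    by (simp only: * qconst_mult qconst_of_nat)
  finally have "of_nat ((2 * a + 2) * (2 * a + 1)) * hh (2 * (a + 1)) tt (- uu) =
      (tt + of_nat (a + 1)) * (tt + of_nat a * (- uu)) * hh (2 * a) tt (- uu)"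
    unfolding hh_even P_def by (simp only: mult_ac)
  then have "c * (- s * hh (2 * (a + 1)) tt (- uu)) =
      (of_nat a * uu - tt) * (tt + of_nat (a + 1)) * (s * hh (2 * a) tt (- uu))"
    if "c = of_nat ((2 * a + 2) * (2 * a + 1))" for s c
    unfolding that by algebra
  from this[OF refl, of "(-1) ^ a"] show ?thesis
    by (simp only: B_series_def fps_nth_Abs_fps power_add power_one_right mult_minus1_right)
qed

text \<open>The hypergeometric differential equation, read off from the coefficient recurrence.\<close>

lemma B_series_ode:
  "4 * (fps_X * fps_deriv (fps_deriv B_series)) + 2 * fps_deriv B_series =
    fps_const uu * (fps_X * (fps_X * fps_deriv (fps_deriv B_series)))
    + fps_const ((tt + 2) * uu - tt) * (fps_X * fps_deriv B_series)
    - fps_const (tt * (tt + 1)) * B_series" (is "?L = ?R")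
proof (rule fps_ext)
  fix n
  have L: "?L $ n = of_nat ((2 * n + 2) * (2 * n + 1)) * B_series $ (n + 1)"
    by (cases n) (simp_all add: numeral_fps_const algebra_simps)
  have "?R $ n = (of_nat n * (of_nat n - 1) * uu + of_nat n * ((tt + 2) * uu - tt) - tt * (tt + 1)) *
      B_series $ n"
    by (cases n; cases "n - 1") (simp_all add: algebra_simps)
  also have "\<dots> = (of_nat n * uu - tt) * (tt + of_nat (n + 1)) * B_series $ n"
    by (simp add: algebra_simps)
  finally show "?L $ n = ?R $ n"
    using L B_series_rec[of n] by simp
qed

text \<open>
  Since \<open>B' = - A B\<close> and \<open>B'' = (A\<^sup>2 - A') B\<close>, the second-order linear equation of \<open>B\<close> has \<open>B\<close> as a
  factor; cancelling it leaves a first-order quadratic equation for \<open>A\<close>.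
\<close>

lemma log_deriv_riccati:
  "4 * (fps_X * (fps_deriv log_deriv - log_deriv * log_deriv)) + 2 * log_deriv =
    fps_const uu * (fps_X * (fps_X * (fps_deriv log_deriv - log_deriv * log_deriv)))
    + fps_const ((tt + 2) * uu - tt) * (fps_X * log_deriv) + fps_const (tt * (tt + 1))"
    (is "?L = ?R")
proof -
  have D2: "fps_deriv (fps_deriv B_series) =
      (log_deriv * log_deriv - fps_deriv log_deriv) * B_series"
    by (simp add: fps_deriv_B_series algebra_simps)
  have "B_series * ?L = - (4 * (fps_X * fps_deriv (fps_deriv B_series)) + 2 * fps_deriv B_series)"
    unfolding D2 unfolding fps_deriv_B_series by (simp add: algebra_simps)
  also have "\<dots> = B_series * ?R"
    unfolding B_series_ode unfolding D2 unfolding fps_deriv_B_series by (simp add: algebra_simps)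
  finally have "B_series * ?L = B_series * ?R" .
  moreover have "B_series \<noteq> 0" using B_series_nth_0 by (metis fps_zero_nth zero_neq_one)
  ultimately show ?thesis by (simp only: mult_cancel_left simp_thms)
qed

lemma log_deriv_coeff_0: "2 * log_deriv_coeff 0 = tt * (tt + 1)"
  using arg_cong[OF log_deriv_riccati, of "\<lambda>f. f $ 0"] by (simp add: log_deriv_def)

text \<open>
  The coefficient of $x^{r+1}$ in the Riccati equation.  The two terms with a minus sign are what
  makes both nonnegativity and integrality nontrivial.
\<close>

lemma log_deriv_coeff_rec:
  "of_nat (4 * r + 6) * log_deriv_coeff (r + 1) =
    4 * (\<Sum>i\<le>r. log_deriv_coeff i * log_deriv_coeff (r - i))
    - uu * (\<Sum>i<r. log_deriv_coeff i * log_deriv_coeff (r - 1 - i))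
    + (of_nat (r + 2) * uu + tt * uu - tt) * log_deriv_coeff r"
proof -
  have sq: "(log_deriv * log_deriv) $ n = (\<Sum>i\<le>n. log_deriv_coeff i * log_deriv_coeff (n - i))" for n
    by (simp add: fps_mult_nth log_deriv_def atLeast0AtMost)
  have sq': "(if r = 0 then 0 else (log_deriv * log_deriv) $ (r - 1)) =
      (\<Sum>i<r. log_deriv_coeff i * log_deriv_coeff (r - 1 - i))"
    by (cases r) (simp_all add: sq lessThan_Suc_atMost)
  have "4 * (of_nat (r + 1) * log_deriv_coeff (r + 1) - (log_deriv * log_deriv) $ r)
      + 2 * log_deriv_coeff (r + 1) =
    uu * (of_nat r * log_deriv_coeff r - (if r = 0 then 0 else (log_deriv * log_deriv) $ (r - 1)))
      + ((tt + 2) * uu - tt) * log_deriv_coeff r"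
    using arg_cong[OF log_deriv_riccati, of "\<lambda>f. f $ (r + 1)"]
    by (cases r) (simp_all add: log_deriv_def numeral_fps_const del: of_nat_Suc)
  then show ?thesis unfolding sq'[symmetric] sq[symmetric]
    by (simp add: algebra_simps)
qed

section \<open>Nonnegativity\<close>

text \<open>
  Nonnegative and integral coefficients are established separately, so the closure properties are
  stated for coefficients in an arbitrary set \<open>S\<close> of rationals.
\<close>

definition polys_over :: "rat set \<Rightarrow> qtu set"
  where "polys_over S = {p. \<forall>i j. coeff (coeff p j) i \<in> S}"

lemma polys_over_sum:
  assumes "0 \<in> S" "\<And>a b. a \<in> S \<Longrightarrow> b \<in> S \<Longrightarrow> a + b \<in> S"
    and "\<And>x. x \<in> A \<Longrightarrow> f x \<in> polys_over S"
  shows "sum f A \<in> polys_over S"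
proof -
  have "sum g A \<in> S" if "\<And>x. x \<in> A \<Longrightarrow> g x \<in> S" for g :: "_ \<Rightarrow> rat"
    using that by (induction A rule: infinite_finite_induct) (use assms(1,2) in auto)
  then show ?thesis using assms(3) by (simp add: polys_over_def coeff_sum)
qed

lemma polys_over_mult:
  assumes S: "0 \<in> S" "\<And>a b. a \<in> S \<Longrightarrow> b \<in> S \<Longrightarrow> a + b \<in> S" "\<And>a b. a \<in> S \<Longrightarrow> b \<in> S \<Longrightarrow> a * b \<in> S"
    and "p \<in> polys_over S" "q \<in> polys_over S"
  shows "p * q \<in> polys_over S"
proof -
  have "sum g A \<in> S" if "\<And>x. x \<in> A \<Longrightarrow> g x \<in> S" for g :: "nat \<Rightarrow> rat" and A
    using that by (induction A rule: infinite_finite_induct) (use S in auto)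
  then show ?thesis using assms(4,5) S(3) by (simp add: polys_over_def coeff_mult coeff_sum)
qed

lemma polys_over_basic:
  assumes "0 \<in> S" "1 \<in> S"
  shows "tt \<in> polys_over S" "uu \<in> polys_over S" "c \<in> S \<Longrightarrow> qconst c \<in> polys_over S"
  using assms by (auto simp: polys_over_def tt_def uu_def qconst_def coeff_pCons one_pCons split: nat.splits)

abbreviation nonneg_polys :: "qtu set" where "nonneg_polys \<equiv> polys_over {0..}"
abbreviation int_polys :: "qtu set" where "int_polys \<equiv> polys_over \<int>"

lemma nonneg_polys_add: "p \<in> nonneg_polys \<Longrightarrow> q \<in> nonneg_polys \<Longrightarrow> p + q \<in> nonneg_polys"
  by (simp add: polys_over_def)

lemmas nonneg_polys_intros =
  nonneg_polys_add
  polys_over_sum[of "{0..}", simplified]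
  polys_over_mult[of "{0..}", simplified]
  polys_over_basic[of "{0..}", simplified]

lemma int_polys_add: "p \<in> int_polys \<Longrightarrow> q \<in> int_polys \<Longrightarrow> p + q \<in> int_polys"
  and int_polys_diff: "p \<in> int_polys \<Longrightarrow> q \<in> int_polys \<Longrightarrow> p - q \<in> int_polys"
  by (simp_all add: polys_over_def)

lemmas int_polys_intros = 
  int_polys_add int_polys_diff
  polys_over_sum[of "\<int>", simplified]
  polys_over_mult[of "\<int>", simplified]
  polys_over_basic[of "\<int>", simplified]

lemma of_nat_in_nonneg_polys: "of_nat n \<in> nonneg_polys"
  unfolding qconst_of_nat[symmetric] by (intro nonneg_polys_intros) simp

lemma of_nat_in_int_polys: "of_nat n \<in> int_polys"
  unfolding qconst_of_nat[symmetric] by (intro int_polys_intros) simp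

lemma nat_polys_eq: "nat_polys = int_polys \<inter> nonneg_polys"
  by (auto simp: nat_polys_def polys_over_def Nats_altdef2)

lemma nonneg_polys_cancel:
  assumes "of_nat n * p \<in> nonneg_polys" "n > 0"
  shows "p \<in> nonneg_polys"
proof -
  have "qconst (1 / of_nat n) * (of_nat n * p) \<in> nonneg_polys"
    by (rule polys_over_mult[OF _ _ _ _ assms(1)]) (simp_all add: polys_over_basic)
  moreover have "qconst (1 / of_nat n) * (of_nat n * p) = p"
    using assms(2) by (simp add: mult.assoc[symmetric] qconst_1 flip: qconst_of_nat qconst_mult)
  ultimately show ?thesis by simp
qed

text \<open>
  The negative terms of the recurrence are absorbed by positive ones.  As \<open>4 a\<^sub>0 - t = 2t\<^sup>2 + t\<close>, the
  term \<open>4 a\<^sub>0 a\<^sub>r\<close> of the first convolution dominates \<open>t a\<^sub>r\<close>; the remaining terms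
  \<open>4 a\<^sub>i\<^sub>+\<^sub>1 a\<^sub>j\<close> dominate the terms \<open>u a\<^sub>i a\<^sub>j\<close> of the second convolution as soon as
  \<open>4 a\<^sub>i\<^sub>+\<^sub>1 - u a\<^sub>i\<close> is nonnegative.  This inequality is therefore carried along in the induction; it
  propagates because the term \<open>(r + 2) u a\<^sub>r\<close> exceeds \<open>(4r + 6) u a\<^sub>r / 4\<close>.
\<close>

lemma log_deriv_coeff_nonneg:
  "log_deriv_coeff r \<in> nonneg_polys \<and>
   (\<forall>i<r. 4 * log_deriv_coeff (i + 1) - uu * log_deriv_coeff i \<in> nonneg_polys)"
proof (induction r rule: less_induct)
  case (less r)
  let ?a = log_deriv_coeff
  have num: "numeral k \<in> nonneg_polys" for k
    using of_nat_in_nonneg_polys[of "numeral k"] by simp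
  show ?case
  proof (cases r)
    case 0
    have "of_nat 2 * ?a 0 \<in> nonneg_polys"
      using polys_over_mult[of "{0..}" tt "tt + of_nat 1"] log_deriv_coeff_0 of_nat_in_nonneg_polys[of 1]
      by (simp add: nonneg_polys_add polys_over_basic)
    then have "?a 0 \<in> nonneg_polys" by (rule nonneg_polys_cancel) simp
    then show ?thesis using 0 by simp
  next
    case (Suc s)
    have pos: "?a i \<in> nonneg_polys" if "i \<le> s" for i
      using less[of i] that Suc by simp
    have step: "4 * ?a (i + 1) - uu * ?a i \<in> nonneg_polys" if "i < s" for i
      using less[of s] that Suc by simp
    \<comment> \<open>all of the right-hand side of the recurrence except for the term \<open>(s + 2) u a\<^sub>s\<close>, regrouped
      so that every summand is visibly nonnegative\<close>
    define E where "E = (2 * tt * tt + tt) * ?a s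
      + (\<Sum>i<s. (4 * ?a (i + 1) - uu * ?a i) * ?a (s - 1 - i)) + uu * tt * ?a s"
    have tt0: "2 * tt * tt + tt = 4 * ?a 0 - tt"
      using log_deriv_coeff_0 by algebra
    have "(\<Sum>i\<le>s. ?a i * ?a (s - i)) = ?a 0 * ?a s + (\<Sum>i<s. ?a (i + 1) * ?a (s - 1 - i))"
      by (cases s) (simp_all add: sum.atMost_Suc_shift lessThan_Suc_atMost del: sum.atMost_Suc)
    then have E: "of_nat (4 * s + 6) * ?a (s + 1) = E + of_nat (s + 2) * uu * ?a s"
      unfolding log_deriv_coeff_rec E_def tt0
      by (simp add: algebra_simps sum.distrib sum_subtractf sum_distrib_left)
    have "E \<in> nonneg_polys"
      unfolding E_def by (intro nonneg_polys_intros num pos step) auto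
    have "?a (s + 1) \<in> nonneg_polys"
      by (rule nonneg_polys_cancel[of "4 * s + 6"], unfold E)
        (intro nonneg_polys_intros of_nat_in_nonneg_polys pos \<open>E \<in> nonneg_polys\<close>, simp_all)
    moreover have "4 * ?a (s + 1) - uu * ?a s \<in> nonneg_polys"
    proof (rule nonneg_polys_cancel[of "4 * s + 6"])
      have "of_nat (4 * s + 6) * (4 * ?a (s + 1) - uu * ?a s) = 4 * E + 2 * (uu * ?a s)"
        using E by (simp add: algebra_simps)
      also have "\<dots> \<in> nonneg_polys"
        by (intro nonneg_polys_intros num pos \<open>E \<in> nonneg_polys\<close>) simp
      finally show "of_nat (4 * s + 6) * (4 * ?a (s + 1) - uu * ?a s) \<in> nonneg_polys" .
    qed simp
    ultimately show ?thesis using step Suc by (auto simp: less_Suc_eq)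
  qed
qed

section \<open>Integrality\<close>

lemma log_deriv_coeff_eq_Lambda:
  "log_deriv_coeff r = qconst (1 / (2 * fact (2 * r + 1))) * Lambda (r + 1)"
proof -
  have "(fact (2 * (r + 1)) / of_nat (r + 1) :: rat) = 2 * fact (2 * r + 1)"
    by (simp add: divide_simps)
  then have "qconst (1 / (2 * fact (2 * r + 1))) * Lambda (r + 1) =
      qconst (1 / (2 * fact (2 * r + 1)) * (2 * fact (2 * r + 1))) * log_deriv_coeff r"
    unfolding Lambda_def by (simp only: mult.assoc qconst_mult add_diff_cancel_right')
  then show ?thesis by (simp add: qconst_1 del: fact_Suc)
qed

lemma even_binomial_odd:
  assumes "even n" "odd k"
  shows "even (n choose k)"
proof (cases n)
  case (Suc m)
  obtain l where k: "k = Suc l" using assms(2) by (cases k) auto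
  have "Suc l * (Suc m choose Suc l) = Suc m * (m choose l)"
    by (metis Suc_times_binomial)
  then have "even (k * (n choose k))" using Suc k assms(1) by (metis even_mult_iff)
  then show ?thesis using assms(2) by simp
qed (use assms in \<open>auto elim: oddE\<close>)

text \<open>
  With the normalisation \<open>\<Lambda>\<close> the denominators of the recurrence turn into binomial coefficients.
  The one with a spare factor \<open>1/2\<close> is \<open>2r choose (2i + 1)\<close>, which is even.
\<close>

lemma Lambda_rec:
  "Lambda (r + 2) =
    (\<Sum>i\<le>r. of_nat ((2 * r + 2) choose (2 * i + 1)) * (Lambda (i + 1) * Lambda (r - i + 1)))
    - uu * (\<Sum>i<r. of_nat ((r + 1) * (2 * r + 1) * ((2 * r choose (2 * i + 1)) div 2)) *
        (Lambda (i + 1) * Lambda (r - 1 - i + 1)))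
    + of_nat (r + 1) * (of_nat (r + 2) * uu + tt * uu - tt) * Lambda (r + 1)"
proof -
  let ?a = log_deriv_coeff and ?f = "qconst (fact (2 * r + 2))"
  have "Lambda (r + 2) = qconst (fact (2 * r + 2) * of_nat (4 * r + 6)) * ?a (r + 1)"
  proof -
    have "(fact (2 * (r + 2)) / of_nat (r + 2) :: rat) = fact (2 * r + 2) * of_nat (4 * r + 6)"
      by (simp add: fact_reduce divide_simps) (simp add: algebra_simps)
    then show ?thesis by (simp add: Lambda_def)
  qed
  also have "\<dots> = ?f * (of_nat (4 * r + 6) * ?a (r + 1))"
    by (simp only: qconst_mult qconst_of_nat mult.assoc)
  also have "\<dots> = (\<Sum>i\<le>r. ?f * 4 * (?a i * ?a (r - i)))
      - uu * (\<Sum>i<r. ?f * (?a i * ?a (r - 1 - i)))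
      + ?f * ((of_nat (r + 2) * uu + tt * uu - tt) * ?a r)"
    unfolding log_deriv_coeff_rec sum_distrib_left[symmetric] mult.assoc
    by (simp only: distrib_left right_diff_distrib mult_ac)
  also have "(\<Sum>i\<le>r. ?f * 4 * (?a i * ?a (r - i))) =
      (\<Sum>i\<le>r. of_nat ((2 * r + 2) choose (2 * i + 1)) * (Lambda (i + 1) * Lambda (r - i + 1)))"
  proof (rule sum.cong)
    fix i assume "i \<in> {..r}"
    then have i: "i \<le> r" by simp
    have "2 * r + 2 - (2 * i + 1) = 2 * (r - i) + 1" using i by simp
    then have "of_nat ((2 * r + 2) choose (2 * i + 1)) =
      (fact (2 * r + 2) * 4 * (1 / (2 * fact (2 * i + 1)) * (1 / (2 * fact (2 * (r - i) + 1)))) :: rat)"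
      using binomial_fact[of "2 * i + 1" "2 * r + 2", where 'a = rat] i by simp
    then have "of_nat ((2 * r + 2) choose (2 * i + 1)) =
      ?f * 4 * (qconst (1 / (2 * fact (2 * i + 1))) * qconst (1 / (2 * fact (2 * (r - i) + 1))))"
      by (metis qconst_mult qconst_of_nat qconst_numeral)
    then show "?f * 4 * (?a i * ?a (r - i)) =
        of_nat ((2 * r + 2) choose (2 * i + 1)) * (Lambda (i + 1) * Lambda (r - i + 1))"
      unfolding log_deriv_coeff_eq_Lambda by (simp only: mult_ac)
  qed simp
  also have "(\<Sum>i<r. ?f * (?a i * ?a (r - 1 - i))) =
      (\<Sum>i<r. of_nat ((r + 1) * (2 * r + 1) * ((2 * r choose (2 * i + 1)) div 2)) *
        (Lambda (i + 1) * Lambda (r - 1 - i + 1)))"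
  proof (rule sum.cong)
    fix i assume "i \<in> {..<r}"
    then have i: "i < r" by simp
    have e: "2 * r - (2 * i + 1) = 2 * (r - 1 - i) + 1" using i by simp
    have "2 * ((2 * r choose (2 * i + 1)) div 2) = 2 * r choose (2 * i + 1)"
      by (simp add: even_binomial_odd)
    then have "2 * (of_nat ((2 * r choose (2 * i + 1)) div 2) :: rat) = of_nat (2 * r choose (2 * i + 1))"
      by (metis of_nat_mult of_nat_numeral)
    also have "\<dots> = fact (2 * r) / (fact (2 * i + 1) * fact (2 * (r - 1 - i) + 1))"
      using binomial_fact[of "2 * i + 1" "2 * r", where 'a = rat] i unfolding e by simp
    finally have c: "of_nat ((2 * r choose (2 * i + 1)) div 2) =
        fact (2 * r) / (2 * fact (2 * i + 1) * fact (2 * (r - 1 - i) + 1) :: rat)"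
      by (simp add: divide_simps mult_ac)
    have "of_nat ((r + 1) * (2 * r + 1) * ((2 * r choose (2 * i + 1)) div 2)) =
      (fact (2 * r + 2) * (1 / (2 * fact (2 * i + 1)) * (1 / (2 * fact (2 * (r - 1 - i) + 1)))) :: rat)"
      unfolding of_nat_mult c by (simp add: fact_reduce[of "2 * r + 2"] fact_reduce[of "2 * r + 1"] divide_simps)
    then have "of_nat ((r + 1) * (2 * r + 1) * ((2 * r choose (2 * i + 1)) div 2)) =
      ?f * (qconst (1 / (2 * fact (2 * i + 1))) * qconst (1 / (2 * fact (2 * (r - 1 - i) + 1))))"
      by (metis qconst_mult qconst_of_nat)
    then show "?f * (?a i * ?a (r - 1 - i)) =
        of_nat ((r + 1) * (2 * r + 1) * ((2 * r choose (2 * i + 1)) div 2)) *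
        (Lambda (i + 1) * Lambda (r - 1 - i + 1))"
      unfolding log_deriv_coeff_eq_Lambda by (simp only: mult_ac)
  qed simp
  also have "?f * ((of_nat (r + 2) * uu + tt * uu - tt) * ?a r) =
      of_nat (r + 1) * (of_nat (r + 2) * uu + tt * uu - tt) * Lambda (r + 1)"
  proof -
    have "(of_nat (r + 1) :: rat) = fact (2 * r + 2) * (1 / (2 * fact (2 * r + 1)))"
      by (simp add: divide_simps)
    then have "of_nat (r + 1) = ?f * qconst (1 / (2 * fact (2 * r + 1)))"
      by (metis qconst_mult qconst_of_nat)
    then show ?thesis unfolding log_deriv_coeff_eq_Lambda by (simp only: mult_ac)
  qed
  finally show ?thesis .
qed

lemma Lambda_int: "Lambda (r + 1) \<in> int_polys"
proof (induction r rule: less_induct)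
  case (less r)
  show ?case
  proof (cases r)
    case 0
    have "Lambda (0 + 1) = tt * (tt + of_nat 1)"
      using log_deriv_coeff_0 by (simp add: Lambda_def qconst_numeral)
    then show ?thesis
      by (simp only: 0) (intro int_polys_intros of_nat_in_int_polys)
  next
    case (Suc s)
    have IH: "Lambda (i + 1) \<in> int_polys" if "i \<le> s" for i
      using less[of i] that Suc by simp
    have "Lambda (s + 2) \<in> int_polys"
      unfolding Lambda_rec by (intro int_polys_intros of_nat_in_int_polys IH) auto
    then show ?thesis by (simp add: Suc)
  qed
qed

lemma Lambda_nat_polys:
  assumes "N \<ge> 1"
  shows "Lambda N \<in> nat_polys"
proof -
  obtain r where N: "N = r + 1" using assms by (metis le_add_diff_inverse2)
  have "Lambda N \<in> nonneg_polys"
    unfolding Lambda_def using log_deriv_coeff_nonneg by (intro nonneg_polys_intros) auto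
  then show ?thesis using Lambda_int N by (simp add: nat_polys_eq)
qed

section \<open>Specialisation at \<open>u = 1\<close> and \<open>t = m\<close>\<close>

text \<open>
  A polynomial in \<open>t\<close> is determined by its values at the positive integers, so it suffices to treat
  the specialisation \<open>u = 1\<close>, \<open>t = m\<close>, where everything becomes a power series over the rationals.
\<close>

definition specialise :: "nat \<Rightarrow> qtu \<Rightarrow> rat"
  where "specialise m p = poly (poly p 1) (of_nat m)"

lemma specialise_simps [simp]:
  "specialise m (p + q) = specialise m p + specialise m q" "specialise m (p - q) = specialise m p - specialise m q" "specialise m (- p) = - specialise m p"
  "specialise m (p * q) = specialise m p * specialise m q" "specialise m (sum f A) = (\<Sum>x\<in>A. specialise m (f x))"
  "specialise m (of_nat n) = of_nat n" "specialise m 1 = 1" "specialise m tt = of_nat m" "specialise m uu = 1"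
  by (simp_all add: specialise_def poly_sum tt_def uu_def)

text \<open>
  This is a polynomial of degree \<open>m\<close>, namely \<open>det(1 - x M)\<close> for the \<open>m \<times> m\<close> matrix \<open>M\<close> with entries
  \<open>min i j\<close>.
\<close>

definition B_at :: "nat \<Rightarrow> rat fps"
  where "B_at m = Abs_fps (\<lambda>a. (-1) ^ a * of_nat ((m + a) choose (2 * a)))"

lemma specialise_B_series: "specialise m (B_series $ a) = B_at m $ a"
proof (induction a)
  case 0
  show ?case by (simp add: B_series_nth_0 B_at_def)
next
  case (Suc a)
  have "(2 * a + 2) * ((m + a + 1) choose (2 * a + 2)) = (m + a + 1) * ((m + a) choose (2 * a + 1))"
    using Suc_times_binomial[of "2 * a + 1" "m + a"] by simp
  moreover have "(2 * a + 1) * ((m + a) choose (2 * a + 1)) = (m + a - 2 * a) * ((m + a) choose (2 * a))"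
    using binomial_absorb_comp[of "m + a" "2 * a"] binomial_absorption[of "2 * a" "m + a"] by simp
  moreover have "of_nat (m + a - 2 * a) * of_nat ((m + a) choose (2 * a)) =
      (of_nat m - of_nat a :: rat) * of_nat ((m + a) choose (2 * a))"
    by (cases "a \<le> m") (simp_all add: of_nat_diff binomial_eq_0)
  ultimately have "of_nat ((2 * a + 2) * (2 * a + 1)) * of_nat ((m + Suc a) choose (2 * Suc a)) =
      (of_nat m - of_nat a) * of_nat (m + a + 1) * (of_nat ((m + a) choose (2 * a)) :: rat)"
    by (metis (no_types, opaque_lifting) add_Suc_right mult.assoc mult.left_commute of_nat_mult
        Suc_eq_plus1 add_2_eq_Suc' mult_Suc_right add.commute)
  then have "c * (- s * of_nat ((m + Suc a) choose (2 * Suc a))) =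
      (of_nat a - of_nat m) * of_nat (m + a + 1) * (s * (of_nat ((m + a) choose (2 * a)) :: rat))"
    if "c = of_nat ((2 * a + 2) * (2 * a + 1))" for s c
    unfolding that by algebra
  from this[OF refl, of "(-1) ^ a"]
  have "of_nat ((2 * a + 2) * (2 * a + 1)) * B_at m $ Suc a =
      (of_nat a - of_nat m) * (of_nat m + of_nat (a + 1)) * B_at m $ a"
    by (simp only: B_at_def fps_nth_Abs_fps power_Suc mult_minus1 add.assoc of_nat_add)
  also have "\<dots> = specialise m (of_nat ((2 * a + 2) * (2 * a + 1)) * B_series $ (a + 1))"
    unfolding B_series_rec by (simp add: Suc)
  finally have "of_nat ((2 * a + 2) * (2 * a + 1)) * B_at m $ Suc a =
      of_nat ((2 * a + 2) * (2 * a + 1)) * specialise m (B_series $ Suc a)"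
    by (simp only: specialise_simps Suc_eq_plus1)
  then show ?case by (simp only: mult_cancel_left of_nat_eq_0_iff) simp
qed

section \<open>The resolvent of the kernel \<open>min\<close>\<close>

lemma B_at_0: "B_at 0 = 1"
  by (rule fps_ext) (simp add: B_at_def binomial_eq_0 fps_one_nth)

lemma B_at_nth_0: "B_at m $ 0 = 1"
  by (simp add: B_at_def)

text \<open>
  At \<open>l = 0\<close> the truncated difference \<open>l - 1 = 0\<close> gives the right value: the sequence
  continued to \<open>- 1\<close> by its recurrence has there the value \<open>B\<^sub>0 = 1\<close>.
\<close>

lemma B_at_Suc: "B_at (Suc l) = (2 - fps_X) * B_at l - B_at (l - 1)"
proof (cases l)
  case 0
  have "B_at 1 = 1 - fps_X"
  proof (rule fps_ext)
    fix n show "B_at 1 $ n = (1 - fps_X :: rat fps) $ n"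
      by (cases n; cases "n - 1") (auto simp: B_at_def binomial_eq_0 numeral_2_eq_2)
  qed
  then show ?thesis by (simp add: 0 B_at_0)
next
  case (Suc m)
  have "B_at (m + 2) = 2 * B_at (m + 1) - fps_X * B_at (m + 1) - B_at m"
  proof (rule fps_ext)
    fix n
    show "B_at (m + 2) $ n = (2 * B_at (m + 1) - fps_X * B_at (m + 1) - B_at m) $ n"
    proof (cases n)
      case (Suc a)
      let ?n = "Suc (m + a)"
      have "(Suc (Suc ?n) choose (2 * a + 2)) + (?n choose (2 * a + 2)) =
          2 * (Suc ?n choose (2 * a + 2)) + (?n choose (2 * a))"
        by simp
      then have "(of_nat (Suc (Suc ?n) choose (2 * a + 2)) + of_nat (?n choose (2 * a + 2)) :: rat) =
          2 * of_nat (Suc ?n choose (2 * a + 2)) + of_nat (?n choose (2 * a))"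
        by (metis of_nat_add of_nat_mult of_nat_numeral)
      then have "of_nat (Suc (Suc ?n) choose (2 * a + 2)) = 2 * of_nat (Suc ?n choose (2 * a + 2))
          + of_nat (?n choose (2 * a)) - (of_nat (?n choose (2 * a + 2)) :: rat)"
        by linarith
      then have "c * of_nat (Suc (Suc ?n) choose (2 * a + 2)) =
          2 * (c * of_nat (Suc ?n choose (2 * a + 2))) + c * of_nat (?n choose (2 * a))
          - c * (of_nat (?n choose (2 * a + 2)) :: rat)" for c
        by (simp only: distrib_left right_diff_distrib mult.left_commute)
      from this[of "(-1) ^ a"] show ?thesis
        by (simp add: Suc B_at_def numeral_fps_const algebra_simps del: binomial_Suc_Suc)
    qed (simp add: B_at_def)
  qed
  then show ?thesis by (simp add: Suc algebra_simps)
qed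

text \<open>
  The solution of the recurrence of \<^const>\<open>B_at\<close> that vanishes at \<open>0\<close>: the Chebyshev polynomials
  \<open>U\<^sub>i\<^sub>-\<^sub>1\<close> of the second kind in the argument \<open>1 - x/2\<close>.
\<close>

fun cheb :: "nat \<Rightarrow> rat fps" where
  "cheb 0 = 0"
| "cheb (Suc 0) = 1"
| "cheb (Suc (Suc i)) = (2 - fps_X) * cheb (Suc i) - cheb i"

text \<open>
  As a function of \<open>j\<close> with \<open>j + l\<close> fixed, the left-hand side is the Wronskian of two solutions of
  the same recurrence, hence constant; \<open>j = 0\<close> gives its value.
\<close>

lemma cheb_B_at_wronskian: "cheb (Suc j) * B_at l - cheb j * B_at (l - 1) = B_at (j + l)"
proof (induction j arbitrary: l)
  case (Suc j)
  show ?case using Suc[of "Suc l"] by (simp add: B_at_Suc algebra_simps)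
qed simp

text \<open>
  Differentiating the recurrence of \<^const>\<open>B_at\<close> with respect to \<open>x\<close> yields the same recurrence with
  the inhomogeneous term \<open>- B\<close>.  The convolution with the solution \<^const>\<open>cheb\<close> solves the
  equation with the opposite inhomogeneity.
\<close>

lemma sum_cheb_B_at: "(\<Sum>j\<le>m. cheb j * B_at (m - j)) = - fps_deriv (B_at m)"
proof (induction m rule: cheb.induct)
  case 1
  show ?case by (simp add: B_at_0)
next
  case 2
  show ?case by (simp add: B_at_Suc B_at_0)
next
  case (3 m)
  let ?s = "\<lambda>m. \<Sum>j\<le>m. cheb j * B_at (m - j)"
  have shift: "?s (Suc m) = (\<Sum>j\<le>m. cheb (Suc j) * B_at (m - j))"
    by (simp add: sum.atMost_Suc_shift del: sum.atMost_Suc)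
  have "?s (Suc (Suc m)) = B_at (Suc m) + (\<Sum>j\<le>m. cheb (Suc (Suc j)) * B_at (m - j))"
    by (simp add: sum.atMost_Suc_shift del: sum.atMost_Suc cheb.simps(3))
  also have "(\<Sum>j\<le>m. cheb (Suc (Suc j)) * B_at (m - j)) = (2 - fps_X) * ?s (Suc m) - ?s m"
    unfolding shift by (simp add: algebra_simps sum_subtractf sum.distrib sum_distrib_left)
  also have "B_at (Suc m) + \<dots> = - fps_deriv (B_at (Suc (Suc m)))"
    unfolding 3 B_at_Suc[of "Suc m"] by (simp add: algebra_simps)
  finally show ?case .
qed

text \<open>
  The entries of the matrix \<open>M (1 + x M + x\<^sup>2 M\<^sup>2 + \<dots>)\<close> multiplied by \<open>det(1 - x M)\<close>.  As for any discrete
  second-order boundary value problem, the Green function is a product of the solution satisfying the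
  left boundary condition \<open>v 0 = 0\<close> and the one satisfying the right condition \<open>v (m + 1) = v m\<close>.
  The truncated difference makes the value at \<open>j = m + 1\<close> agree with that at \<open>j = m\<close>.
\<close>

definition green_numerator :: "nat \<Rightarrow> nat \<Rightarrow> nat \<Rightarrow> rat fps"
  where "green_numerator m i j = cheb (min i j) * B_at (m - max i j)"

lemma green_numerator_difference:
  assumes "i \<le> m" "1 \<le> k" "k \<le> m" "1 \<le> i"
  shows "2 * green_numerator m i k - green_numerator m i (k + 1) - green_numerator m i (k - 1) =
    fps_X * green_numerator m i k + (if k = i then B_at m else 0)"
proof -
  obtain l where k: "k = Suc l" using assms by (cases k) auto
  consider "k < i" | "k = i" | "k > i" by linarith
  then show ?thesis
  proof cases
    case 1
    then show ?thesis by (simp add: green_numerator_def k algebra_simps)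
  next
    case 2
    have "cheb (Suc (Suc l)) * B_at (m - k) - cheb (Suc l) * B_at (m - k - 1) = B_at m"
      using cheb_B_at_wronskian[of "Suc l" "m - k"] assms(3) by (simp add: k)
    then show ?thesis using 2[symmetric] by (simp add: green_numerator_def k algebra_simps)
  next
    case 3
    have "m - l = Suc (m - k)" using assms k by simp
    then have "B_at (m - l) = (2 - fps_X) * B_at (m - k) - B_at (m - k - 1)"
      using B_at_Suc[of "m - k"] by simp
    then have "green_numerator m i (k - 1) = cheb i * ((2 - fps_X) * B_at (m - k) - B_at (m - k - 1))"
      using 3 by (simp add: green_numerator_def k)
    moreover have "green_numerator m i k = cheb i * B_at (m - k)" "green_numerator m i (k + 1) = cheb i * B_at (m - k - 1)"
      using 3 by (simp_all add: green_numerator_def)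
    ultimately show ?thesis using 3 by (simp only: if_False) (simp add: algebra_simps)
  qed
qed

text \<open>
  The kernel \<open>min\<close> inverts the negative second difference: it is the Green function for the boundary
  conditions \<open>v 0 = 0\<close> and \<open>v (m + 1) = v m\<close>.
\<close>

lemma sum_second_difference_min:
  fixes v :: "nat \<Rightarrow> 'a :: comm_ring_1"
  assumes "v 0 = 0" "v (m + 1) = v m" "j \<le> m"
  shows "(\<Sum>k = 1..m. (2 * v k - v (k + 1) - v (k - 1)) * of_nat (min k j)) = v j"
  using assms(3)
proof (induction j)
  case (Suc j)
  let ?w = "\<lambda>k. 2 * v k - v (k + 1) - v (k - 1)"
  have "(\<Sum>k = 1..m. ?w k * of_nat (min k (Suc j))) =
      (\<Sum>k = 1..m. ?w k * of_nat (min k j) + (if j < k then ?w k else 0))"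
    by (intro sum.cong refl) (auto simp: min_def algebra_simps not_le le_Suc_eq)
  also have "\<dots> = v j + (\<Sum>k \<in> {k \<in> {1..m}. j < k}. ?w k)"
    using Suc by (simp only: sum.distrib sum.inter_filter finite_atLeastAtMost)
  also have "{k \<in> {1..m}. j < k} = {Suc j..m}" by auto
  also have "(\<Sum>k = Suc j..m. ?w k) = (\<Sum>k = Suc j..m. (v k - v (k - 1)) - (v (Suc k) - v (Suc k - 1)))"
    by (intro sum.cong refl) (simp add: algebra_simps)
  also have "\<dots> = v (Suc j) - v j"
    using sum_Suc_diff[of "Suc j" m "\<lambda>k. - (v k - v (k - 1))"] Suc.prems assms(2)
    by (simp add: algebra_simps sum_subtractf sum.distrib)
  finally show ?case by simp
qed (simp add: assms)

lemma green_numerator_rec: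
  assumes "1 \<le> i" "i \<le> m" "j \<le> m"
  shows "green_numerator m i j = B_at m * of_nat (min i j) + fps_X * (\<Sum>k = 1..m. green_numerator m i k * of_nat (min k j))"
proof -
  have "green_numerator m i j =
      (\<Sum>k = 1..m. (2 * green_numerator m i k - green_numerator m i (k + 1) - green_numerator m i (k - 1)) * of_nat (min k j))"
    using assms by (intro sum_second_difference_min[symmetric]) (auto simp: green_numerator_def max_def)
  also have "\<dots> = (\<Sum>k = 1..m. (fps_X * green_numerator m i k + (if k = i then B_at m else 0)) * of_nat (min k j))"
    by (intro sum.cong refl, subst green_numerator_difference) (use assms in auto)
  also have "\<dots> = (\<Sum>k = 1..m. (if k = i then B_at m * of_nat (min k j) else 0)
      + fps_X * (green_numerator m i k * of_nat (min k j)))"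
    by (intro sum.cong refl) (simp add: algebra_simps)
  also have "\<dots> = B_at m * of_nat (min i j) + fps_X * (\<Sum>k = 1..m. green_numerator m i k * of_nat (min k j))"
    using assms by (simp add: sum.distrib sum_distrib_left)
  finally show ?thesis .
qed

section \<open>Zigzag paths\<close>

text \<open>
  Paths of \<open>n\<close> steps from \<open>i\<close> to \<open>j\<close> along the even positions; an odd position holds a common lower
  bound of its two neighbours.
\<close>

definition zigzags :: "nat \<Rightarrow> nat \<Rightarrow> nat \<Rightarrow> nat \<Rightarrow> (nat \<Rightarrow> nat) set"
  where "zigzags m n i j = {f \<in> {0..2 * n} \<rightarrow>\<^sub>E {1..m}. f 0 = i \<and> f (2 * n) = j \<and>
    (\<forall>s<n. f (2 * s + 1) \<le> f (2 * s) \<and> f (2 * s + 1) \<le> f (2 * s + 2))}"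

lemma finite_zigzags: "finite (zigzags m n i j)"
  by (rule finite_subset[of _ "{0..2 * n} \<rightarrow>\<^sub>E {1..m}"]) (auto simp: zigzags_def intro!: finite_PiE)

lemma card_zigzags_0:
  assumes "1 \<le> i" "i \<le> m"
  shows "card (zigzags m 0 i j) = (if i = j then 1 else 0)"
proof (cases "i = j")
  case True
  have "zigzags m 0 i j = {restrict (\<lambda>_. i) {0}}"
    using assms True by (auto simp: zigzags_def PiE_def extensional_def)
  then show ?thesis using True by simp
next
  case False
  then have "zigzags m 0 i j = {}" by (auto simp: zigzags_def)
  then show ?thesis using False by simp
qed

text \<open>
  Two consecutive peaks \<open>k\<close> and \<open>j\<close> admit \<open>min k j\<close> valleys between them, so that
  \<^const>\<open>zigzags\<close> counts the entries of the \<open>n\<close>-th power of the matrix \<open>min\<close>.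
\<close>

lemma card_zigzags_Suc:
  assumes "1 \<le> j" "j \<le> m"
  shows "card (zigzags m (Suc n) i j) = (\<Sum>k = 1..m. card (zigzags m n i k) * min k j)"
proof -
  have "bij_betw (\<lambda>f. (f (2 * n), restrict f {0..2 * n}, f (2 * n + 1))) (zigzags m (Suc n) i j)
      (SIGMA k : {1..m}. zigzags m n i k \<times> {1..min k j})"
  proof (rule bij_betwI[where g = "\<lambda>(k, g, a). g(2 * n + 1 := a, 2 * n + 2 := j)"])
    show "(\<lambda>f. (f (2 * n), restrict f {0..2 * n}, f (2 * n + 1))) \<in> zigzags m (Suc n) i j \<rightarrow>
        (SIGMA k : {1..m}. zigzags m n i k \<times> {1..min k j})"
      by (auto simp: zigzags_def PiE_iff)
    show "(\<lambda>(k, g, a). g(2 * n + 1 := a, 2 * n + 2 := j)) \<in>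
        (SIGMA k : {1..m}. zigzags m n i k \<times> {1..min k j}) \<rightarrow> zigzags m (Suc n) i j"
      using assms
      by (auto simp: zigzags_def PiE_iff extensional_def less_Suc_eq le_Suc_eq)
    show "(case (f (2 * n), restrict f {0..2 * n}, f (2 * n + 1)) of (k, g, a) \<Rightarrow>
        g(2 * n + 1 := a, 2 * n + 2 := j)) = f" if "f \<in> zigzags m (Suc n) i j" for f
      using that by (auto simp: zigzags_def PiE_iff extensional_def fun_eq_iff)
    show "(\<lambda>f. (f (2 * n), restrict f {0..2 * n}, f (2 * n + 1)))
        (case y of (k, g, a) \<Rightarrow> g(2 * n + 1 := a, 2 * n + 2 := j)) = y"
      if "y \<in> (SIGMA k : {1..m}. zigzags m n i k \<times> {1..min k j})" for y
      using that by (auto simp: zigzags_def PiE_iff extensional_def fun_eq_iff)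
  qed
  then have "card (zigzags m (Suc n) i j) =
      card (SIGMA k : {1..m}. zigzags m n i k \<times> {1..min k j})"
    by (rule bij_betw_same_card)
  also have "\<dots> = (\<Sum>k = 1..m. card (zigzags m n i k) * min k j)"
    by (subst card_SigmaI) (auto simp: finite_zigzags card_cartesian_product)
  finally show ?thesis .
qed

definition zigzag_fps :: "nat \<Rightarrow> nat \<Rightarrow> nat \<Rightarrow> rat fps"
  where "zigzag_fps m i j = Abs_fps (\<lambda>n. of_nat (card (zigzags m (Suc n) i j)))"

lemma zigzag_fps_rec:
  assumes "1 \<le> i" "i \<le> m" "1 \<le> j" "j \<le> m"
  shows "zigzag_fps m i j =
    of_nat (min i j) + fps_X * (\<Sum>k = 1..m. zigzag_fps m i k * of_nat (min k j))"
proof (rule fps_ext)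
  fix n
  show "zigzag_fps m i j $ n =
      (of_nat (min i j) + fps_X * (\<Sum>k = 1..m. zigzag_fps m i k * of_nat (min k j))) $ n"
  proof (cases n)
    case 0
    have "card (zigzags m (Suc 0) i j) = (\<Sum>k = 1..m. if k = i then min k j else 0)"
      unfolding card_zigzags_Suc[OF assms(3,4)]
      by (intro sum.cong refl) (use assms in \<open>auto simp: card_zigzags_0\<close>)
    also have "\<dots> = min i j" using assms by simp
    finally show ?thesis by (simp add: 0 zigzag_fps_def fps_of_nat[symmetric])
  next
    case (Suc l)
    then show ?thesis
      by (simp add: zigzag_fps_def card_zigzags_Suc[OF assms(3,4), of "Suc l"] fps_sum_nth
          flip: fps_of_nat)
  qed
qed

text \<open>
  Both sides solve \<open>Z = B M + x Z M\<close>, and such an equation has only one power series solution.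
\<close>

lemma B_at_mult_zigzag_fps:
  assumes "1 \<le> i" "i \<le> m" "1 \<le> j" "j \<le> m"
  shows "B_at m * zigzag_fps m i j = green_numerator m i j"
proof -
  define E where "E = (\<lambda>j. B_at m * zigzag_fps m i j - green_numerator m i j)"
  have E: "E j = fps_X * (\<Sum>k = 1..m. E k * of_nat (min k j))" if "1 \<le> j" "j \<le> m" for j
    unfolding E_def
    by (subst zigzag_fps_rec[OF assms(1,2) that], subst green_numerator_rec[OF assms(1,2) that(2)])
      (simp add: algebra_simps sum_subtractf sum_distrib_left)
  have "\<forall>j \<in> {1..m}. E j $ n = 0" for n
  proof (induction n)
    case 0
    show ?case using E by (metis atLeastAtMost_iff fps_X_mult_nth)
  next
    case (Suc n)
    show ?case
    proof
      fix j assume "j \<in> {1..m}"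
      then have "E j $ Suc n = (\<Sum>k = 1..m. E k $ n * of_nat (min k j))"
        using E[of j] by (simp add: fps_sum_nth flip: fps_of_nat)
      then show "E j $ Suc n = 0" using Suc by simp
    qed
  qed
  then have "E j = 0" using assms by (intro fps_ext) simp
  then show ?thesis by (simp add: E_def)
qed

text \<open>
  The trace formula \<open>- D'/D = (\<Sum>r. tr(M\<^sup>r\<^sup>+\<^sup>1) x\<^sup>r)\<close> for \<open>D = det(1 - x M)\<close>, obtained by summing the
  diagonal of the explicit resolvent.
\<close>

lemma specialise_log_deriv_coeff: "specialise m (log_deriv_coeff r) = of_nat (\<Sum>j = 1..m. card (zigzags m (Suc r) j j))"
proof -
  define L where "L = Abs_fps (\<lambda>r. specialise m (log_deriv_coeff r))"
  have "B_at m * L = - fps_deriv (B_at m)"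
  proof (rule fps_ext)
    fix n
    have "(L * B_at m) $ n = specialise m ((log_deriv * B_series) $ n)"
      by (simp add: fps_mult_nth L_def log_deriv_def specialise_B_series)
    also have "\<dots> = specialise m (- fps_deriv B_series $ n)" by (simp add: fps_deriv_B_series)
    also have "\<dots> = (- fps_deriv (B_at m)) $ n" using specialise_B_series by simp
    finally show "(B_at m * L) $ n = (- fps_deriv (B_at m)) $ n" by (simp add: mult.commute)
  qed
  also have "\<dots> = (\<Sum>j = 1..m. cheb j * B_at (m - j))"
    unfolding sum_cheb_B_at[symmetric] atMost_atLeast0 by (simp add: sum.atLeast_Suc_atMost)
  also have "\<dots> = B_at m * (\<Sum>j = 1..m. zigzag_fps m j j)"
    unfolding sum_distrib_left by (intro sum.cong refl) (simp add: B_at_mult_zigzag_fps green_numerator_def)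
  finally have "B_at m * L = B_at m * (\<Sum>j = 1..m. zigzag_fps m j j)" .
  moreover have "B_at m \<noteq> 0" using B_at_nth_0 by (metis fps_zero_nth zero_neq_one)
  ultimately have "L = (\<Sum>j = 1..m. zigzag_fps m j j)" by simp
  from arg_cong[OF this, of "\<lambda>f. f $ r"] show ?thesis
    by (simp add: L_def zigzag_fps_def fps_sum_nth)
qed

section \<open>Order-preserving maps of circular fences\<close>

lemma circ_fence_le_monotone_iff:
  fixes f :: "nat \<Rightarrow> 'a :: preorder"
  assumes "N \<ge> 1"
  shows "(\<forall>(x, y) \<in> circ_fence_le N. f x \<le> f y) \<longleftrightarrow>
    (\<forall>s<N. f (2 * s + 1) \<le> (f(0 := f (2 * N))) (2 * s) \<and> f (2 * s + 1) \<le> f (2 * s + 2))"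
    (is "?L \<longleftrightarrow> ?R")
proof
  assume L: ?L
  show ?R
  proof (intro allI impI conjI)
    fix s assume s: "s < N"
    have "(2 * s + 1, 2 * s + 2) \<in> circ_fence_le N"
      using s by (force simp: circ_fence_le_def circ_fence_less_def circ_fence_def)
    with L show "f (2 * s + 1) \<le> f (2 * s + 2)" by blast
    \<comment> \<open>position \<open>0\<close> stands for the fence element \<open>2 N\<close>\<close>
    let ?i = "if s = 0 then 2 * N else 2 * s"
    have "(?i mod (2 * N) + 1, ?i) \<in> circ_fence_le N"
      unfolding circ_fence_le_def circ_fence_less_def circ_fence_def
      by (rule UnI2, rule UnI2, rule CollectI, rule exI[of _ ?i]) (use s in auto)
    moreover have "?i mod (2 * N) = 2 * s" using s by simp
    ultimately have "f (2 * s + 1) \<le> f ?i" using L by fastforce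
    then show "f (2 * s + 1) \<le> (f(0 := f (2 * N))) (2 * s)" by auto
  qed
next
  assume R: ?R
  have "f x \<le> f y" if xy: "(x, y) \<in> circ_fence_le N" for x y
  proof -
    consider "x = y" | i where "x = i" "y = i + 1" "i \<in> circ_fence N" "odd i"
      | i where "x = i mod (2 * N) + 1" "y = i" "i \<in> circ_fence N" "even i"
      using xy unfolding circ_fence_le_def circ_fence_less_def by blast
    then show ?thesis
    proof cases
      case (2 i)
      then obtain s where "i = 2 * s + 1" by (auto elim: oddE)
      with 2 R show ?thesis by (auto simp: circ_fence_def)
    next
      case (3 i)
      then obtain s where i: "i = 2 * s" by (auto elim: evenE)
      show ?thesis
      proof (cases "s = N")
        case True
        with 3 R i assms show ?thesis by auto
      next
        case False
        with 3 i have "0 < s" "s < N" by (auto simp: circ_fence_def)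
        with R 3 i show ?thesis by auto
      qed
    qed simp
  qed
  then show ?L by blast
qed

text \<open>
  Cutting the fence open at its maximal element \<open>2 N\<close>, whose value is copied to the new position \<open>0\<close>,
  turns an order-preserving map into a closed zigzag path.
\<close>

lemma card_order_preserving_maps_circ_fence:
  assumes "N \<ge> 1"
  shows "card (order_preserving_maps (circ_fence N) (circ_fence_le N) m) =
    (\<Sum>j = 1..m. card (zigzags m N j j))"
proof -
  have "bij_betw (\<lambda>f. f(0 := f (2 * N)))
      (order_preserving_maps (circ_fence N) (circ_fence_le N) m) (\<Union>j\<in>{1..m}. zigzags m N j j)"
  proof (rule bij_betwI[where g = "\<lambda>f. f(0 := undefined)"])
    show "(\<lambda>f. f(0 := f (2 * N))) \<in>
        order_preserving_maps (circ_fence N) (circ_fence_le N) m \<rightarrow> (\<Union>j\<in>{1..m}. zigzags m N j j)"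
      unfolding order_preserving_maps_def circ_fence_le_monotone_iff[OF assms]
      using assms by (auto simp: zigzags_def circ_fence_def PiE_iff extensional_def)
    show "(\<lambda>f. f(0 := undefined)) \<in>
        (\<Union>j\<in>{1..m}. zigzags m N j j) \<rightarrow> order_preserving_maps (circ_fence N) (circ_fence_le N) m"
      unfolding order_preserving_maps_def circ_fence_le_monotone_iff[OF assms]
      using assms by (auto simp: zigzags_def circ_fence_def PiE_iff extensional_def)
    show "(f(0 := f (2 * N)))(0 := undefined) = f"
      if "f \<in> order_preserving_maps (circ_fence N) (circ_fence_le N) m" for f
      using that by (auto simp: order_preserving_maps_def circ_fence_def PiE_iff extensional_def)
    show "(g(0 := undefined))(0 := (g(0 := undefined)) (2 * N)) = g"
      if "g \<in> (\<Union>j\<in>{1..m}. zigzags m N j j)" for g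
      using that assms by (auto simp: zigzags_def)
  qed
  then have "card (order_preserving_maps (circ_fence N) (circ_fence_le N) m) =
      card (\<Union>j\<in>{1..m}. zigzags m N j j)"
    by (rule bij_betw_same_card)
  also have "\<dots> = (\<Sum>j = 1..m. card (zigzags m N j j))"
    by (subst card_UN_disjoint) (auto simp: finite_zigzags, auto simp: zigzags_def)
  finally show ?thesis .
qed

lemma log_deriv_coeff_at_1:
  assumes "N \<ge> 1"
  shows "poly (log_deriv_coeff (N - 1)) 1 = order_polynomial (circ_fence N) (circ_fence_le N)"
proof (rule order_polynomial_unique, intro allI impI)
  fix m :: nat assume "m \<ge> 1"
  have "poly (poly (log_deriv_coeff (N - 1)) 1) (of_nat m) =
      of_nat (card (order_preserving_maps (circ_fence N) (circ_fence_le N) m))"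
    using specialise_log_deriv_coeff[of m "N - 1"] assms
    by (simp add: specialise_def card_order_preserving_maps_circ_fence)
  also have "\<dots> = poly (order_polynomial (circ_fence N) (circ_fence_le N)) (of_nat m)"
    using order_polynomial[OF partial_order_on_circ_fence _ \<open>m \<ge> 1\<close>] by (simp add: circ_fence_def)
  finally show "poly (poly (log_deriv_coeff (N - 1)) 1) (of_nat m) =
      poly (order_polynomial (circ_fence N) (circ_fence_le N)) (of_nat m)" .
qed

theorem proposition4p8:
  shows "(\<forall>N \<ge> 1. Lambda N \<in> nat_polys) \<and>
    F_even = exp_fps (Abs_fps (\<lambda>N. if N \<ge> 1 then Lambda N * qconst (1 / fact (2 * N)) else 0)) \<and>
    (\<forall>N \<ge> 1. poly (Lambda N) 1 =
      smult (fact (2 * N) / of_nat N) (order_polynomial (circ_fence N) (circ_fence_le N)))"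
proof (intro conjI allI impI)
  fix N :: nat assume N: "N \<ge> 1"
  show "Lambda N \<in> nat_polys" using N by (rule Lambda_nat_polys)
  show "poly (Lambda N) 1 =
      smult (fact (2 * N) / of_nat N) (order_polynomial (circ_fence N) (circ_fence_le N))"
    by (simp add: Lambda_def qconst_def flip: log_deriv_coeff_at_1[OF N])
qed (rule F_even_eq_exp_fps)

end
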